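(* Let $\Omega\subset\mathbb{R}^d$ with $d>1$ be a convex body or a finite union of convex bodies. Let $\mathcal{P}_{d,n}$ be either the total degree space $\mathcal{P}^T_{d,n}$ or the maximum degree space $\mathcal{P}^M_{d,n}$, and set $\mathcal{M}(\Omega)=\frac{4d^2}{\omega(\Omega)}$ for the maximum degree space and $\mathcal{M}(\Omega)=\frac{4}{\omega(\Omega)}$ for the total degree space. Let $0<c\le\frac{1}{2\sqrt d}$ be a fixed constant. Construct a set of $M$ sample points $\boldsymbol{X}=\{\mathbf{x}_i\}_{1\le i\le M}\subset\Omega$ such that for all $\mathbf{x}\in\Omega$ the mesh condition $$\inf_{\mathbf{x}_i\in\boldsymbol{X}}\|\mathbf{x}_i-\mathbf{x}\|_\infty\le\frac{c}{\mathcal{M}(\Omega)\,n^2}$$ holds. Then $$\|p\|_\Omega\le 2\|p\|_{\boldsymbol{X}}\qquad\text{for all } p\in\mathcal{P}_{d,n}.$$ Using an equispaced discretization of $\Omega$, the cardinality of $\boldsymbol{X}$ satisfies $|\boldsymbol{X}|=O(n^{2d})=O(N^2)$, where $N$ is the number of basis functions of $\mathcal{P}_{d,n}$; the $O(\cdot)$ notation involves constants that depend on $d$.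
   Context: A convex body is a convex compact subset of $\mathbb{R}^d$ with non-empty interior. $\omega(\Omega)$ denotes the minimal distance between two parallel supporting hyperplanes for $\Omega$. $\|p\|_\Omega=\sup_{\mathbf{x}\in\Omega}|p(\mathbf{x})|$ and $\|p\|_{\boldsymbol{X}}=\max_{\mathbf{x}\in\boldsymbol{X}}|p(\mathbf{x})|$. $\mathcal{P}^T_{d,n}$ is the space of real polynomials in $d$ variables spanned by the monomials $x_{(1)}^{\alpha_1}\cdots x_{(d)}^{\alpha_d}$ with $\sum_{r=1}^d\alpha_r\le n$ (so $N=\binom{n+d}{n}$). $\mathcal{P}^M_{d,n}$ is the space spanned by those monomials with $\max_{1\le r\le d}\alpha_r\le n$ (so $N=(n+1)^d$). Equispaced discretization of a compact set $\Omega\subset\mathbb{R}^d$: take a bounding box (hypercube) $\Omega_{cube}\supset\Omega$, define an equispaced grid of points on $\Omega_{cube}$ (here, dense enough that the mesh condition is satisfied), and restrict this grid to the points contained in $\Omega$.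
   Formalization: For a finite union of convex bodies, ω(Ω) is taken as the smallest width ω of the bodies forming the union; with the width of the union itself the claim fails (three tiny discs at the vertices of a triangle, n=2, sampled at their centres). For a single convex body ω is unchanged. *)

theory Defs
  imports "HOL-Analysis.Analysis" "HOL-Library.Landau_Symbols"
begin

definition convex_body :: "'a::euclidean_space set \<Rightarrow> bool" where
  "convex_body S \<longleftrightarrow> convex S \<and> compact S \<and> interior S \<noteq> {}"

definition supporting_hyperplane :: "'a::euclidean_space set \<Rightarrow> 'a set \<Rightarrow> bool" where
  "supporting_hyperplane S H \<longleftrightarrow>
     (\<exists>a b. a \<noteq> 0 \<and> H = {x. a \<bullet> x = b} \<and> S \<subseteq> {x. a \<bullet> x \<le> b} \<and> H \<inter> S \<noteq> {})"

definition parallel_hyperplanes :: "'a::euclidean_space set \<Rightarrow> 'a set \<Rightarrow> bool" where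
  "parallel_hyperplanes H H' \<longleftrightarrow>
     (\<exists>a b b'. a \<noteq> 0 \<and> H = {x. a \<bullet> x = b} \<and> H' = {x. a \<bullet> x = b'})"

text \<open>The two hyperplanes must be distinct: a hyperplane is parallel to itself, and without
  this requirement the infimum would always be 0.\<close>

definition min_width :: "'a::euclidean_space set \<Rightarrow> real" where
  "min_width S = Inf {setdist H H' | H H'.
     supporting_hyperplane S H \<and> supporting_hyperplane S H' \<and>
     parallel_hyperplanes H H' \<and> H \<noteq> H'}"

text \<open>For a union of convex bodies the width is taken to be the smallest width of a member of
  the family. Mere support of the whole union by two hyperplanes would not do: the union of
  three tiny discs centred at the vertices of a large triangle then has large width, and the
  mesh condition for quadratic polynomials is met by the three centres alone, where a nonzero
  quadratic can vanish. A single convex body is the family with one member, and for it this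
  is the minimal width of the body.\<close>

definition family_width :: "'a::euclidean_space set set \<Rightarrow> real" where
  "family_width \<K> = Min (min_width ` \<K>)"

datatype degree_kind = Total | Maximum

fun exponents :: "degree_kind \<Rightarrow> nat \<Rightarrow> ('d::finite \<Rightarrow> nat) set" where
  "exponents Total n = {\<alpha>. (\<Sum>r\<in>UNIV. \<alpha> r) \<le> n}"
| "exponents Maximum n = {\<alpha>. Max (range \<alpha>) \<le> n}"

lemma finite_exponents: "finite (exponents D n :: ('d::finite \<Rightarrow> nat) set)"
proof -
  have "\<alpha> r \<le> n" if "\<alpha> \<in> exponents D n" for \<alpha> :: "'d \<Rightarrow> nat" and r
    using that member_le_sum[of r UNIV \<alpha>] Max_ge[of "range \<alpha>" "\<alpha> r"]
    by (cases D) (auto simp del: Max_ge)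
  then have "exponents D n \<subseteq> (UNIV :: 'd set) \<rightarrow>\<^sub>E {..n}"
    by auto
  then show ?thesis
    by (rule finite_subset) (simp add: finite_PiE)
qed

definition poly_space :: "degree_kind \<Rightarrow> nat \<Rightarrow> (real ^ 'd \<Rightarrow> real) set" where
  "poly_space D n =
     {p. \<exists>coef. p = (\<lambda>x. \<Sum>\<alpha>\<in>exponents D n. coef \<alpha> * (\<Prod>r\<in>UNIV. x $ r ^ \<alpha> r))}"

fun markov_factor :: "degree_kind \<Rightarrow> (real ^ 'd) set set \<Rightarrow> real" where
  "markov_factor Total \<K> = 4 / family_width \<K>"
| "markov_factor Maximum \<K> = 4 * real CARD('d) ^ 2 / family_width \<K>"

definition mesh_condition :: "(real ^ 'd) set \<Rightarrow> (real ^ 'd) set \<Rightarrow> real \<Rightarrow> bool" where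
  "mesh_condition \<Omega> X h \<longleftrightarrow> (\<forall>x\<in>\<Omega>. (INF y\<in>X. infnorm (y - x)) \<le> h)"

definition hypercube :: "real ^ 'd \<Rightarrow> real \<Rightarrow> (real ^ 'd) set" where
  "hypercube a L = {x. \<forall>r. a $ r \<le> x $ r \<and> x $ r \<le> a $ r + L}"

text \<open>The parameter \<open>m > 0\<close> is the number of grid intervals on each side of the
  hypercube, so that the grid has \<open>m + 1\<close> points per side, with spacing \<open>L / m\<close>.\<close>

definition equispaced_grid :: "real ^ 'd \<Rightarrow> real \<Rightarrow> nat \<Rightarrow> (real ^ 'd) set" where
  "equispaced_grid a L m = {x. \<forall>r. \<exists>i\<le>m. x $ r = a $ r + real i * (L / real m)}"

end

(* On a segment, Markov's inequality at an endpoint follows by comparison with the Chebyshev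
   polynomial. Every direction contains points of a convex body K of width w at height at least
   w/2 above or below a given x in K, so the endpoint inequality on the chord from x to such a
   point bounds the gradient of p at x by 4 n^2 |p|_K / w; at a maximiser of p the lower
   supporting point has height at least w and the bound improves to 2 n^2 |p|_K / w. Iterating the
   first bound controls all Taylor coefficients of p at a maximiser, so moving by at most
   w / (8 n^2) from it, even out of K, changes p by at most
   |p|_K (1/4 + sum_{k>=2} (1/2)^k / k!) <= |p|_K / 2. *)

theory Submission
  imports Defs
begin

section \<open>Markov's inequality at an endpoint\<close>

text \<open>An endpoint inequality is the right tool because a maximiser may be an extreme point of
  the body: it then starts many chords but lies inside none. A chord is always run over the
  parameter interval [0, 1], so its length never enters; only the difference of heights at its ends
  does, and this is what the width controls. The discretization is a separate matter. Near the
  boundary the closest grid points of the bounding cube may all lie outside the set. A point is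
  therefore moved inwards before it is rounded, to the centre of a ball contained in the set whose
  radius is a fixed proportion of the allowed move. A grid with a constant times n^2 intervals per
  side already meets every such ball, which gives the order n^(2d).\<close>

fun chebyshev :: "nat \<Rightarrow> real poly" where
  "chebyshev 0 = 1"
| "chebyshev (Suc 0) = [:0, 1:]"
| "chebyshev (Suc (Suc n)) = [:0, 2:] * chebyshev (Suc n) - chebyshev n"

lemma poly_chebyshev_cos: "poly (chebyshev n) (cos t) = cos (real n * t)"
proof (induction n rule: chebyshev.induct)
  case (3 n)
  have "cos (real (Suc (Suc n)) * t) + cos (real n * t) = 2 * cos t * cos (real (Suc n) * t)"
    using cos_add[of "real (Suc n) * t" t] cos_diff[of "real (Suc n) * t" t]
    by (simp add: algebra_simps)
  with 3 show ?case
    by (simp add: algebra_simps)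
qed auto

lemma degree_chebyshev_le: "degree (chebyshev n) \<le> n"
proof (induction n rule: chebyshev.induct)
  case (3 n)
  have "degree ([:0, 2:] * chebyshev (Suc n)) \<le> 1 + Suc n"
    using 3(1) by (intro order.trans[OF degree_mult_le] add_mono) auto
  with 3(2) show ?case
    by (auto intro!: degree_diff_le)
qed auto

text \<open>The cosine identity degenerates at t = 0, where the derivative of \<open>cos\<close>
  vanishes, so the differentiated recursion is used instead: 2 + 2 (n+1)^2 - n^2 = (n+2)^2.\<close>

lemma poly_pderiv_chebyshev_1: "poly (pderiv (chebyshev n)) 1 = (real n)\<^sup>2"
proof (induction n rule: chebyshev.induct)
  case (3 n)
  have "poly (chebyshev (Suc n)) 1 = 1"
    using poly_chebyshev_cos[of "Suc n" 0] by simp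
  with 3 show ?case
    by (simp add: pderiv_diff pderiv_mult pderiv_smult pderiv_pCons power2_eq_square algebra_simps)
qed (auto simp: pderiv_pCons)

text \<open>There is a root between consecutive nodes and hence a critical point between consecutive roots;
  with the critical point \<open>x 0\<close> the derivative has one root too many.\<close>

lemma alternating_sign_roots:
  fixes r :: "real poly" and x :: "nat \<Rightarrow> real"
  assumes x: "\<And>j. j < n \<Longrightarrow> x (Suc j) < x j"
    and sign: "\<And>j. j \<le> n \<Longrightarrow> 0 < (-1) ^ j * poly r (x j)"
    and deg: "degree r \<le> n" and "n > 0"
    and crit: "poly (pderiv r) (x 0) = 0"
  shows False
proof -
  have "\<exists>z. x (Suc j) < z \<and> z < x j \<and> poly r z = 0" if "j < n" for j
  proof (cases "even j")
    case True
    with sign[of j] sign[of "Suc j"] that show ?thesis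
      by (intro poly_IVT_pos) (auto simp: x)
  next
    case False
    with sign[of j] sign[of "Suc j"] that show ?thesis
      by (intro poly_IVT_neg) (auto simp: x)
  qed
  then obtain z where z: "\<And>j. j < n \<Longrightarrow> x (Suc j) < z j \<and> z j < x j \<and> poly r (z j) = 0"
    by metis
  have "\<exists>w. z (Suc j) < w \<and> w < z j \<and> poly (pderiv r) w = 0" if "Suc j < n" for j
  proof -
    have "z (Suc j) < z j"
      using z[of j] z[of "Suc j"] that by force
    from poly_MVT[OF this, of r] show ?thesis
      using z[of j] z[of "Suc j"] that by auto
  qed
  then obtain w where w: "\<And>j. Suc j < n \<Longrightarrow> z (Suc j) < w j \<and> w j < z j \<and> poly (pderiv r) (w j) = 0"
    by metis
  \<comment> \<open>The critical points \<open>w j\<close>, with j < n - 1, all lie below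
    \<open>z 0\<close>, which lies below \<open>x 0\<close>. Prefixing \<open>x 0\<close> gives n
    distinct roots of a derivative of degree at most n - 1.\<close>
  define u where "u = case_nat (x 0) w"
  have dec: "u (Suc j) < u j" if "Suc j < n" for j
  proof (cases j)
    case 0
    have "w 0 < z 0" "z 0 < x 0"
      using w[of 0] z[of 0] that 0 by auto
    with 0 show ?thesis
      by (simp add: u_def)
  next
    case (Suc i)
    have "w (Suc i) < z (Suc i)" "z (Suc i) < w i"
      using w[of "Suc i"] w[of i] that Suc by auto
    with Suc show ?thesis
      by (simp add: u_def)
  qed
  have lt: "u j < u i" if "i < j" "j < n" for i j
    using that
  proof (induction j)
    case (Suc j)
    then show ?case
      using dec[of j] by (cases "i = j") auto
  qed auto
  have inj: "inj_on u {..<n}"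
    by (rule linorder_inj_onI') (metis lessThan_iff less_irrefl lt)
  have roots: "u ` {..<n} \<subseteq> {t. poly (pderiv r) t = 0}"
  proof (intro image_subsetI CollectI)
    fix j assume "j \<in> {..<n}"
    then show "poly (pderiv r) (u j) = 0"
      using w crit by (cases j) (auto simp: u_def)
  qed
  have "pderiv r = 0"
  proof (rule ccontr)
    assume nz: "pderiv r \<noteq> 0"
    have "n \<le> card {t. poly (pderiv r) t = 0}"
      using card_mono[OF poly_roots_finite[OF nz] roots] by (simp add: card_image inj)
    also have "\<dots> \<le> degree (pderiv r)"
      by (rule card_poly_roots_bound[OF nz])
    also have "\<dots> \<le> n - 1"
      using deg by (simp add: degree_pderiv)
    finally show False
      using \<open>n > 0\<close> by simp
  qed
  then have "degree r = 0"
    by (simp add: pderiv_eq_0_iff)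
  then obtain b where "r = [:b:]"
    by (rule degree_eq_zeroE)
  then show False
    using sign[of 0] sign[of 1] \<open>n > 0\<close> by simp
qed

text \<open>If the bound failed, scaling Q by \<open>l\<close> so that its derivative at 1 equals
  that of the Chebyshev polynomial would leave \<bar>l Q\<bar> < 1 on [-1, 1]. The difference
  \<open>r\<close> then has the alternating signs of the Chebyshev polynomial at its extrema cos (j
  pi / n), and 1 is a critical point of \<open>r\<close>: exactly the excluded situation.\<close>

lemma markov_endpoint_1:
  fixes Q :: "real poly"
  assumes deg: "degree Q \<le> n" and bd: "\<And>x. \<lbrakk>-1 \<le> x; x \<le> 1\<rbrakk> \<Longrightarrow> \<bar>poly Q x\<bar> \<le> M"
  shows "\<bar>poly (pderiv Q) 1\<bar> \<le> (real n)\<^sup>2 * M"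
proof (cases "n = 0")
  case True
  with deg have "pderiv Q = 0"
    by (simp add: pderiv_eq_0_iff)
  with True show ?thesis
    by simp
next
  case False
  show ?thesis
  proof (rule ccontr)
    assume "\<not> ?thesis"
    then have less: "(real n)\<^sup>2 * M < \<bar>poly (pderiv Q) 1\<bar>"
      by simp
    have "0 \<le> M"
      using bd[of 0] by simp
    with less have nz: "poly (pderiv Q) 1 \<noteq> 0"
      by (smt (verit) mult_nonneg_nonneg zero_le_power2)
    define l where "l = (real n)\<^sup>2 / poly (pderiv Q) 1"
    have lM: "\<bar>l\<bar> * M < 1"
      using less nz by (simp add: l_def abs_divide field_simps)
    define r where "r = chebyshev n - smult l Q"
    define x where "x j = cos (real j * pi / real n)" for j
    have "0 < (-1) ^ j * poly r (x j)" for j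
    proof -
      have "poly (chebyshev n) (x j) = (-1) ^ j"
        using False by (simp add: x_def poly_chebyshev_cos cos_npi)
      moreover have "\<bar>(-1) ^ j * (l * poly Q (x j))\<bar> \<le> \<bar>l\<bar> * M"
        by (auto simp: abs_mult power_abs x_def intro!: mult_left_mono bd)
      ultimately show ?thesis
        using lM by (simp add: r_def right_diff_distrib flip: power_mult_distrib)
    qed
    moreover have "x (Suc j) < x j" if "j < n" for j
    proof -
      have "real (Suc j) * pi \<le> real n * pi"
        using that by (intro mult_right_mono) auto
      then show ?thesis
        unfolding x_def using that by (intro cos_monotone_0_pi) (auto simp: field_simps)
    qed
    moreover have "degree r \<le> n"
      unfolding r_def using deg degree_chebyshev_le
      by (intro degree_diff_le order.trans[OF degree_smult_le])
    moreover have "poly (pderiv r) (x 0) = 0"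
      using nz by (simp add: r_def x_def l_def pderiv_diff pderiv_smult poly_pderiv_chebyshev_1)
    ultimately show False
      using alternating_sign_roots[of n x r] False by blast
  qed
qed

text \<open>The substitution x \<mapsto> (1 - x) / 2 takes the endpoint 1 to 0 and [-1, 1] to
  [0, 1]; its slope -1/2 accounts for the factor 2.\<close>

lemma markov_endpoint_0:
  fixes Q :: "real poly"
  assumes deg: "degree Q \<le> n" and bd: "\<And>x. \<lbrakk>0 \<le> x; x \<le> 1\<rbrakk> \<Longrightarrow> \<bar>poly Q x\<bar> \<le> M"
  shows "\<bar>poly (pderiv Q) 0\<bar> \<le> 2 * (real n)\<^sup>2 * M"
proof -
  define R where "R = pcompose Q [:1/2, -1/2:]"
  have "degree R \<le> n"
    using deg by (simp add: R_def degree_pcompose)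
  then have "\<bar>poly (pderiv R) 1\<bar> \<le> (real n)\<^sup>2 * M"
    by (rule markov_endpoint_1) (auto simp: R_def poly_pcompose intro!: bd)
  then show ?thesis
    by (simp add: R_def pderiv_pcompose poly_pcompose pderiv_pCons abs_mult)
qed

section \<open>Polynomials on convex bodies\<close>

text \<open>The index is an upper bound for the total degree, not the degree. Linear forms
  \<open>a \<bullet> x\<close> replace coordinates, so that restriction to a line and
  differentiation go by rule induction; coordinates return as \<open>axis r 1\<close>.\<close>

inductive polyfun_deg :: "nat \<Rightarrow> ('a::real_inner \<Rightarrow> real) \<Rightarrow> bool" where
  const: "polyfun_deg n (\<lambda>x. b)"
| add: "\<lbrakk>polyfun_deg n p; polyfun_deg n q\<rbrakk> \<Longrightarrow> polyfun_deg n (\<lambda>x. p x + q x)"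
| inner_mult: "polyfun_deg n p \<Longrightarrow> polyfun_deg (Suc n) (\<lambda>x. (a \<bullet> x) * p x)"

lemma polyfun_deg_mono: "polyfun_deg n p \<Longrightarrow> n \<le> m \<Longrightarrow> polyfun_deg m p"
proof (induction arbitrary: m rule: polyfun_deg.induct)
  case (inner_mult n p a)
  then show ?case
    by (cases m) (auto intro: polyfun_deg.inner_mult)
qed (auto intro: polyfun_deg.intros)

lemma polyfun_deg_cmult: "polyfun_deg n p \<Longrightarrow> polyfun_deg n (\<lambda>x. b * p x)"
proof (induction rule: polyfun_deg.induct)
  case (inner_mult n p a)
  from polyfun_deg.inner_mult[OF inner_mult.IH, of a] show ?case
    by (simp add: mult.left_commute)
qed (auto simp: distrib_left intro: polyfun_deg.intros)

lemma polyfun_deg_sum: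
  "(\<And>i. i \<in> I \<Longrightarrow> polyfun_deg n (p i)) \<Longrightarrow> polyfun_deg n (\<lambda>x. \<Sum>i\<in>I. p i x)"
  by (induction I rule: infinite_finite_induct) (auto intro: polyfun_deg.intros)

lemma polyfun_deg_power_mult:
  "polyfun_deg n p \<Longrightarrow> polyfun_deg (k + n) (\<lambda>x. (a \<bullet> x) ^ k * p x)"
proof (induction k)
  case (Suc k)
  from polyfun_deg.inner_mult[OF Suc.IH[OF Suc.prems], of a] show ?case
    by (simp add: mult.assoc)
qed auto

lemma polyfun_deg_monomial:
  fixes \<alpha> :: "'d::finite \<Rightarrow> nat"
  assumes "finite I"
  shows "polyfun_deg (\<Sum>r\<in>I. \<alpha> r) (\<lambda>x::real^'d. \<Prod>r\<in>I. x $ r ^ \<alpha> r)"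
  using assms
proof (induction I rule: finite_induct)
  case (insert r I)
  from polyfun_deg_power_mult[OF insert.IH, of "\<alpha> r" "axis r 1"] show ?case
    using insert.hyps by (simp add: inner_axis' )
qed (auto intro: polyfun_deg.const)

lemma polyfun_deg_continuous_on: "polyfun_deg n p \<Longrightarrow> continuous_on S p"
  by (induction rule: polyfun_deg.induct) (auto intro!: continuous_intros)

lemma polyfun_deg_line:
  "polyfun_deg n p \<Longrightarrow> \<exists>q. degree q \<le> n \<and> (\<forall>t. p (x + t *\<^sub>R v) = poly q t)"
proof (induction rule: polyfun_deg.induct)
  case (const n b)
  show ?case
    by (rule exI[of _ "[:b:]"]) simp
next
  case (add n p q)
  then obtain p' q' where "degree p' \<le> n" "\<forall>t. p (x + t *\<^sub>R v) = poly p' t"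
    "degree q' \<le> n" "\<forall>t. q (x + t *\<^sub>R v) = poly q' t"
    by blast
  then show ?case
    by (intro exI[of _ "p' + q'"]) (auto intro: degree_add_le)
next
  case (inner_mult n p a)
  then obtain q where q: "degree q \<le> n" "\<forall>t. p (x + t *\<^sub>R v) = poly q t"
    by blast
  have "degree ([:a \<bullet> x, a \<bullet> v:] * q) \<le> 1 + n"
    using q(1) by (intro order.trans[OF degree_mult_le] add_mono) auto
  with q(2) show ?case
    by (intro exI[of _ "[:a \<bullet> x, a \<bullet> v:] * q"])
      (auto simp: inner_add_right algebra_simps)
qed

section \<open>Gradients of polynomials and their bounds on convex sets\<close>

definition has_gradient :: "('a::real_inner \<Rightarrow> real) \<Rightarrow> ('a \<Rightarrow> 'a) \<Rightarrow> bool" where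
  "has_gradient p G \<longleftrightarrow> (\<forall>x. (p has_derivative (\<lambda>v. G x \<bullet> v)) (at x))"

text \<open>Directional derivatives are only claimed to have degree at most n, not n - 1. This
  suffices for iteration: every differentiation then costs the same constant n^2.\<close>

lemma polyfun_deg_gradient:
  "polyfun_deg n p \<Longrightarrow> \<exists>G. has_gradient p G \<and> (\<forall>v. polyfun_deg n (\<lambda>x. G x \<bullet> v))"
proof (induction rule: polyfun_deg.induct)
  case (const n b)
  show ?case
    by (rule exI[of _ "\<lambda>x. 0"]) (auto simp: has_gradient_def intro: polyfun_deg.const)
next
  case (add n p q)
  then obtain G H where "has_gradient p G" "\<forall>v. polyfun_deg n (\<lambda>x. G x \<bullet> v)"
    "has_gradient q H" "\<forall>v. polyfun_deg n (\<lambda>x. H x \<bullet> v)"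
    by blast
  then show ?case
    by (intro exI[of _ "\<lambda>x. G x + H x"])
      (auto simp: has_gradient_def inner_add_left intro!: derivative_intros polyfun_deg.add)
next
  case (inner_mult n p a)
  then obtain G where G: "has_gradient p G" "\<And>v. polyfun_deg n (\<lambda>x. G x \<bullet> v)"
    by blast
  have "((\<lambda>x. (a \<bullet> x) * p x) has_derivative (\<lambda>v. (p x *\<^sub>R a + (a \<bullet> x) *\<^sub>R G x) \<bullet> v)) (at x)" for x
    using G(1)[unfolded has_gradient_def, rule_format, of x]
    by (auto intro!: derivative_eq_intros simp: inner_add_left)
  moreover have "polyfun_deg (Suc n) (\<lambda>x. (p x *\<^sub>R a + (a \<bullet> x) *\<^sub>R G x) \<bullet> v)" for v
    using polyfun_deg.add[OF polyfun_deg_mono[OF polyfun_deg_cmult[OF inner_mult.hyps, of "a \<bullet> v"]]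
        polyfun_deg.inner_mult[OF G(2)[of v], of a]]
    by (simp add: inner_add_left mult.commute)
  ultimately show ?case
    unfolding has_gradient_def by (intro exI[of _ "\<lambda>x. p x *\<^sub>R a + (a \<bullet> x) *\<^sub>R G x"]) blast
qed

lemma has_gradient_line:
  assumes "has_gradient p G" and "\<And>t. p (x + t *\<^sub>R v) = poly q t"
  shows "poly (pderiv q) t = G (x + t *\<^sub>R v) \<bullet> v"
proof -
  have "((\<lambda>t. x + t *\<^sub>R v) has_derivative (\<lambda>s. s *\<^sub>R v)) (at t)"
    by (auto intro!: derivative_eq_intros)
  then have "((\<lambda>t. p (x + t *\<^sub>R v)) has_derivative (\<lambda>s. G (x + t *\<^sub>R v) \<bullet> (s *\<^sub>R v))) (at t)"
    by (rule has_derivative_compose) (use assms(1) in \<open>simp add: has_gradient_def\<close>)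
  then have "(poly q has_real_derivative G (x + t *\<^sub>R v) \<bullet> v) (at t)"
    unfolding has_field_derivative_def by (simp add: assms(2) mult_commute_abs)
  then show ?thesis
    using DERIV_unique[OF poly_DERIV] by metis
qed

text \<open>Along t \<mapsto> x + t (y - x) the polynomial is bounded by M on [0, 1] by convexity,
  and its slope at 0 is the inner product in question. Nothing is asked of the position of x in
  K.\<close>

lemma gradient_chord_bound:
  assumes "polyfun_deg n p" and "has_gradient p G" and "convex K"
    and bd: "\<And>x. x \<in> K \<Longrightarrow> \<bar>p x\<bar> \<le> M" and "x \<in> K" "y \<in> K"
  shows "\<bar>G x \<bullet> (y - x)\<bar> \<le> 2 * (real n)\<^sup>2 * M"
proof -
  obtain q where q: "degree q \<le> n" "\<And>t. p (x + t *\<^sub>R (y - x)) = poly q t"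
    using polyfun_deg_line[OF assms(1)] by metis
  have "\<bar>poly (pderiv q) 0\<bar> \<le> 2 * (real n)\<^sup>2 * M"
  proof (rule markov_endpoint_0[OF q(1)])
    fix t :: real assume "0 \<le> t" "t \<le> 1"
    then have "(1 - t) *\<^sub>R x + t *\<^sub>R y \<in> K"
      using assms by (auto intro: convexD)
    moreover have "(1 - t) *\<^sub>R x + t *\<^sub>R y = x + t *\<^sub>R (y - x)"
      by (simp add: algebra_simps)
    ultimately show "\<bar>poly q t\<bar> \<le> M"
      using bd q(2) by metis
  qed
  then show ?thesis
    using has_gradient_line[OF assms(2) q(2), of 0] by simp
qed

text \<open>Width expressed by points of K instead of hyperplanes. Being homogeneous in
  \<open>a\<close>, it applies directly to a gradient vector, the zero vector included.\<close>

definition width_at_least :: "'a::real_inner set \<Rightarrow> real \<Rightarrow> bool" where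
  "width_at_least K w \<longleftrightarrow> (\<forall>a. \<exists>s\<in>K. \<exists>t\<in>K. w * norm a \<le> a \<bullet> s - a \<bullet> t)"

text \<open>The direction is the gradient itself. The chords from x to the two extreme points
  together span a height of at least w times its norm, and each contributes at most 2 n^2 M.\<close>

lemma gradient_bound:
  assumes "polyfun_deg n p" and "has_gradient p G" and "convex K" and "width_at_least K w" and "0 < w"
    and bd: "\<And>x. x \<in> K \<Longrightarrow> \<bar>p x\<bar> \<le> M" and "x \<in> K"
  shows "norm (G x) \<le> 4 * (real n)\<^sup>2 * M / w"
proof -
  obtain s t where st: "s \<in> K" "t \<in> K" "w * norm (G x) \<le> G x \<bullet> s - G x \<bullet> t"
    using assms(4) unfolding width_at_least_def by blast
  have "G x \<bullet> s - G x \<bullet> t = G x \<bullet> (s - x) - G x \<bullet> (t - x)"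
    by (simp add: inner_diff_right)
  then have "w * norm (G x) \<le> 4 * (real n)\<^sup>2 * M"
    using gradient_chord_bound[OF assms(1-3) bd \<open>x \<in> K\<close> st(1)]
      gradient_chord_bound[OF assms(1-3) bd \<open>x \<in> K\<close> st(2)] st(3)
    by linarith
  then show ?thesis
    using \<open>0 < w\<close> by (simp add: field_simps)
qed

text \<open>A positive slope towards the upper point s would carry p above M inside K. Hence the
  chord to the lower point t spans the whole height alone, which saves a factor 2.\<close>

lemma gradient_bound_at_maximum:
  assumes "polyfun_deg n p" and "has_gradient p G" and "convex K" and "width_at_least K w" and "0 < w"
    and bd: "\<And>x. x \<in> K \<Longrightarrow> \<bar>p x\<bar> \<le> M" and "x \<in> K" and "p x = M"
  shows "norm (G x) \<le> 2 * (real n)\<^sup>2 * M / w"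
proof -
  obtain s t where st: "s \<in> K" "t \<in> K" "w * norm (G x) \<le> G x \<bullet> s - G x \<bullet> t"
    using assms(4) unfolding width_at_least_def by blast
  have "G x \<bullet> (s - x) \<le> 0"
  proof (rule ccontr)
    assume neg: "\<not> G x \<bullet> (s - x) \<le> 0"
    obtain q where q: "degree q \<le> n" "\<And>t. p (x + t *\<^sub>R (s - x)) = poly q t"
      using polyfun_deg_line[OF assms(1)] by metis
    have "(poly q has_real_derivative G x \<bullet> (s - x)) (at 0)"
      using has_gradient_line[OF assms(2) q(2), of 0] poly_DERIV[of q 0] by simp
    with neg obtain d where d: "0 < d" "\<And>h. \<lbrakk>0 < h; h < d\<rbrakk> \<Longrightarrow> poly q 0 < poly q h"
      using DERIV_pos_inc_right[of "poly q" "G x \<bullet> (s - x)" 0] by auto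
    define h where "h = min 1 (d / 2)"
    have h: "0 < h" "h < d" "h \<le> 1"
      using d(1) by (auto simp: h_def)
    have "(1 - h) *\<^sub>R x + h *\<^sub>R s \<in> K"
      using h assms st by (auto intro: convexD)
    moreover have "(1 - h) *\<^sub>R x + h *\<^sub>R s = x + h *\<^sub>R (s - x)"
      by (simp add: algebra_simps)
    ultimately have "poly q h \<le> M"
      using bd q(2) by (metis abs_le_D1)
    moreover have "poly q 0 = M"
      using q(2)[of 0] \<open>p x = M\<close> by simp
    ultimately show False
      using d(2)[OF h(1,2)] by simp
  qed
  moreover have "G x \<bullet> s - G x \<bullet> t = G x \<bullet> (s - x) - G x \<bullet> (t - x)"
    by (simp add: inner_diff_right)
  ultimately have "w * norm (G x) \<le> 2 * (real n)\<^sup>2 * M"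
    using gradient_chord_bound[OF assms(1-3) bd \<open>x \<in> K\<close> st(2)] st(3)
    by linarith
  then show ?thesis
    using \<open>0 < w\<close> by (simp add: field_simps)
qed

text \<open>The induction replaces p by its derivative along v, q by its derivative, and M by M
  times 4 n^2 |v| / w. The new bound holds on all of K, so the step can be repeated; the points x +
  t v themselves may leave K.\<close>

lemma coeff_line_bound:
  assumes "convex K" and "width_at_least K w" and "0 < w" and "x \<in> K"
    and "polyfun_deg n p" and "\<And>x. x \<in> K \<Longrightarrow> \<bar>p x\<bar> \<le> M"
    and "\<And>t. p (x + t *\<^sub>R v) = poly q t"
  shows "\<bar>coeff q k\<bar> \<le> M * (4 * (real n)\<^sup>2 * norm v / w) ^ k / fact k"
  using assms(5-)
proof (induction k arbitrary: p M q)
  case 0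
  from 0(2)[OF \<open>x \<in> K\<close>] 0(3)[of 0] show ?case
    by (simp add: poly_0_coeff_0)
next
  case (Suc k)
  obtain G where G: "has_gradient p G" "\<And>v. polyfun_deg n (\<lambda>x. G x \<bullet> v)"
    using polyfun_deg_gradient[OF Suc.prems(1)] by blast
  have bd: "\<bar>G y \<bullet> v\<bar> \<le> 4 * (real n)\<^sup>2 * M / w * norm v" if "y \<in> K" for y
    using gradient_bound[OF Suc.prems(1) G(1) assms(1-3) Suc.prems(2) that]
    by (intro order.trans[OF Cauchy_Schwarz_ineq2] mult_right_mono) auto
  define X where "X = M * (4 * (real n)\<^sup>2 * norm v / w) ^ Suc k"
  from Suc.IH[OF G(2) bd has_gradient_line[OF G(1) Suc.prems(3), symmetric]]
  have "real (Suc k) * \<bar>coeff q (Suc k)\<bar> \<le> X / fact k"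
    by (simp add: X_def coeff_pderiv abs_mult mult_ac del: of_nat_Suc)
  then have "\<bar>coeff q (Suc k)\<bar> \<le> X / fact (Suc k)"
    by (simp add: pos_le_divide_eq mult_ac del: of_nat_Suc)
  then show ?case
    by (simp only: X_def)
qed

text \<open>Every coefficient of order k \<ge> 1 is at most M/2 times (1/2)^k, and these bounds sum
  to less than M/2 or to 0 when M = 0. For k \<ge> 2 the leading factor 1/2 comes from k! \<ge> 2;
  for k = 1 it comes from the maximum at x.\<close>

lemma polyfun_deg_perturbation:
  assumes "convex K" and "width_at_least K w" and "0 < w" and "x \<in> K"
    and p: "polyfun_deg n p" and "0 < n" and bd: "\<And>x. x \<in> K \<Longrightarrow> \<bar>p x\<bar> \<le> M" and "p x = M"
    and v: "norm v \<le> w / (8 * (real n)\<^sup>2)"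
  shows "\<bar>p (x + v) - M\<bar> \<le> M / 2"
proof -
  have "0 \<le> M"
    using bd[OF \<open>x \<in> K\<close>] by linarith
  obtain q where q: "degree q \<le> n" "\<And>t. p (x + t *\<^sub>R v) = poly q t"
    using polyfun_deg_line[OF p] by metis
  obtain G where G: "has_gradient p G"
    using polyfun_deg_gradient[OF p] by blast
  have le: "4 * (real n)\<^sup>2 * norm v / w \<le> 1 / 2"
    using v \<open>0 < w\<close> \<open>0 < n\<close> by (simp add: field_simps)
  have coeff: "\<bar>coeff q (Suc i)\<bar> \<le> M / 2 * (1 / 2) ^ Suc i" for i
  proof (cases i)
    case 0
    \<comment> \<open>The general gradient bound would only give M/2 here, and the exponential
      series would then sum to (e^(1/2) - 1) M, which exceeds M/2 for positive M.\<close>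
    have "coeff q (Suc 0) = G x \<bullet> v"
      using has_gradient_line[OF G q(2), of 0] by (simp add: poly_0_coeff_0 coeff_pderiv)
    also have "\<bar>\<dots>\<bar> \<le> 2 * (real n)\<^sup>2 * M / w * norm v"
      using gradient_bound_at_maximum[OF p G assms(1-3) bd \<open>x \<in> K\<close> \<open>p x = M\<close>]
      by (intro order.trans[OF Cauchy_Schwarz_ineq2] mult_right_mono) auto
    also have "\<dots> = M / 2 * (4 * (real n)\<^sup>2 * norm v / w)"
      by simp
    also have "\<dots> \<le> M / 2 * (1 / 2)"
      using le \<open>0 \<le> M\<close> by (intro mult_left_mono) auto
    finally show ?thesis
      using 0 by simp
  next
    case (Suc j)
    have "\<bar>coeff q (Suc i)\<bar> \<le> M * (4 * (real n)\<^sup>2 * norm v / w) ^ Suc i / fact (Suc i)"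
      by (rule coeff_line_bound[OF assms(1-4) p bd q(2)])
    also have "\<dots> \<le> M * (1 / 2) ^ Suc i / 2"
    proof (rule frac_le)
      show "M * (4 * (real n)\<^sup>2 * norm v / w) ^ Suc i \<le> M * (1 / 2) ^ Suc i"
        using le \<open>0 \<le> M\<close> \<open>0 < w\<close> by (intro mult_left_mono power_mono) auto
      have "(2::nat) \<le> fact (Suc i)"
        using fact_ge_self[of "Suc i"] Suc by linarith
      then have "real 2 \<le> real (fact (Suc i))"
        by (simp only: of_nat_le_iff)
      then show "(2::real) \<le> fact (Suc i)"
        by (simp only: of_nat_fact of_nat_numeral)
    qed (use \<open>0 \<le> M\<close> in auto)
    finally show ?thesis
      by simp
  qed
  have "p (x + v) = (\<Sum>i\<le>degree q. coeff q i)"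
    using q(2)[of 1] by (simp add: poly_altdef)
  also have "\<dots> = coeff q 0 + (\<Sum>i<degree q. coeff q (Suc i))"
    by (simp add: sum.atMost_shift)
  also have "coeff q 0 = M"
    using q(2)[of 0] \<open>p x = M\<close> by (simp add: poly_0_coeff_0)
  finally have "\<bar>p (x + v) - M\<bar> \<le> (\<Sum>i<degree q. M / 2 * (1 / 2) ^ Suc i)"
    using coeff by (auto intro!: sum_norm_le[where 'a = real, unfolded real_norm_def])
  also have "\<dots> = M / 2 * (1 - (1 / 2) ^ degree q)"
    by (simp add: geometric_sum flip: sum_distrib_left sum_divide_distrib)
  also have "\<dots> \<le> M / 2"
    using \<open>0 \<le> M\<close> by (intro mult_left_le) auto
  finally show ?thesis .
qed

section \<open>Width of convex bodies\<close>

text \<open>Disjointness from the interior is a condition without sides. The common normal supplied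
  by \<open>parallel_hyperplanes\<close> need not be the outward normal that witnesses support, so a
  one-sided condition would not transfer directly.\<close>

lemma supporting_hyperplane_disjoint_interior:
  assumes "supporting_hyperplane S H"
  shows "H \<inter> interior S = {}"
proof -
  obtain a b where ab: "a \<noteq> 0" "H = {x. a \<bullet> x = b}" "S \<subseteq> {x. a \<bullet> x \<le> b}"
    using assms unfolding supporting_hyperplane_def by blast
  then have "interior S \<subseteq> {x. a \<bullet> x < b}"
    using interior_mono[OF ab(3)] by (simp add: interior_halfspace_le)
  with ab show ?thesis
    by auto
qed

text \<open>Compactness gives a highest and a lowest point. They have different heights, since a
  body inside a hyperplane has empty interior; this makes the two hyperplanes an admissible pair for
  \<open>min_width\<close>.\<close>

lemma convex_body_opposite_supports:
  assumes "convex_body K" and "a \<noteq> 0"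
  obtains s t where "s \<in> K" "t \<in> K" "a \<bullet> t < a \<bullet> s"
    "supporting_hyperplane K {x. a \<bullet> x = a \<bullet> s}" "supporting_hyperplane K {x. a \<bullet> x = a \<bullet> t}"
proof -
  have K: "compact K" "K \<noteq> {}"
    using assms interior_empty by (auto simp: convex_body_def)
  have cont: "continuous_on K (\<lambda>x. a \<bullet> x)"
    by (intro continuous_intros)
  obtain s where s: "s \<in> K" "\<And>x. x \<in> K \<Longrightarrow> a \<bullet> x \<le> a \<bullet> s"
    using continuous_attains_sup[OF K cont] by blast
  obtain t where t: "t \<in> K" "\<And>x. x \<in> K \<Longrightarrow> a \<bullet> t \<le> a \<bullet> x"
    using continuous_attains_inf[OF K cont] by blast
  have "a \<bullet> t < a \<bullet> s"
  proof (rule ccontr)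
    assume "\<not> a \<bullet> t < a \<bullet> s"
    then have "K \<subseteq> {x. a \<bullet> x = a \<bullet> s}"
      using s t by force
    then have "interior K = {}"
      using interior_mono[of K "{x. a \<bullet> x = a \<bullet> s}"] assms(2) by (simp add: interior_hyperplane)
    then show False
      using assms(1) by (simp add: convex_body_def)
  qed
  moreover have "supporting_hyperplane K {x. a \<bullet> x = a \<bullet> s}"
    unfolding supporting_hyperplane_def using s assms(2)
    by (intro exI[of _ a] exI[of _ "a \<bullet> s"]) auto
  moreover have "supporting_hyperplane K {x. a \<bullet> x = a \<bullet> t}"
    unfolding supporting_hyperplane_def using t assms(2)
    by (intro exI[of _ "- a"] exI[of _ "- (a \<bullet> t)"]) auto
  ultimately show ?thesis
    using that s t by blast
qed

lemma convex_body_width_at_least: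
  assumes "convex_body K"
  shows "width_at_least K (min_width K)"
  unfolding width_at_least_def
proof
  fix a
  show "\<exists>s\<in>K. \<exists>t\<in>K. min_width K * norm a \<le> a \<bullet> s - a \<bullet> t"
  proof (cases "a = 0")
    case True
    have "K \<noteq> {}"
      using assms interior_empty by (auto simp: convex_body_def)
    with True show ?thesis
      by auto
  next
    case False
    then obtain s t where st: "s \<in> K" "t \<in> K" "a \<bullet> t < a \<bullet> s"
      "supporting_hyperplane K {x. a \<bullet> x = a \<bullet> s}" "supporting_hyperplane K {x. a \<bullet> x = a \<bullet> t}"
      using convex_body_opposite_supports[OF assms] by blast
    \<comment> \<open>\<open>s - v\<close> is the orthogonal projection of s onto the lower
      hyperplane, so its distance from s is the height difference divided by the norm of
      \<open>a\<close>.\<close>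
    define v where "v = ((a \<bullet> s - a \<bullet> t) / (a \<bullet> a)) *\<^sub>R a"
    have "{x. a \<bullet> x = a \<bullet> s} \<noteq> {x. a \<bullet> x = a \<bullet> t}"
      using st(3) by auto
    moreover have "parallel_hyperplanes {x. a \<bullet> x = a \<bullet> s} {x. a \<bullet> x = a \<bullet> t}"
      unfolding parallel_hyperplanes_def using False by blast
    ultimately have "min_width K \<le> setdist {x. a \<bullet> x = a \<bullet> s} {x. a \<bullet> x = a \<bullet> t}"
      unfolding min_width_def using st(4,5)
      by (intro cInf_lower bdd_belowI[of _ 0]) (auto simp: setdist_pos_le)
    also have "\<dots> \<le> dist s (s - v)"
      using False by (intro setdist_le_dist) (auto simp: v_def inner_diff_right)
    also have "\<dots> = (a \<bullet> s - a \<bullet> t) / norm a"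
      using False st(3) by (simp add: dist_norm v_def divide_simps power2_eq_square flip: power2_norm_eq_inner)
    finally show ?thesis
      using False st(1,2) by (auto simp: field_simps)
  qed
qed

text \<open>If w were at or beyond one level, the segment to w from the point on the other level
  would meet the first level. Every point of that segment except its start is interior, whence the
  parameter range \<open>{0<..1}\<close>: 1 is allowed because w itself is interior.\<close>

lemma interior_between_hyperplanes:
  fixes K :: "'a::euclidean_space set"
  assumes "convex K" and "w \<in> interior K" and "s \<in> K" "s' \<in> K" and "a \<bullet> s < a \<bullet> s'"
    and disj: "{x. a \<bullet> x = a \<bullet> s} \<inter> interior K = {}" "{x. a \<bullet> x = a \<bullet> s'} \<inter> interior K = {}"
  shows "a \<bullet> s < a \<bullet> w" "a \<bullet> w < a \<bullet> s'"
proof -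
  have cross: False if "u \<in> K" "(a \<bullet> u - b) / (a \<bullet> u - a \<bullet> w) \<in> {0<..1}"
    "a \<bullet> u \<noteq> a \<bullet> w" "{x. a \<bullet> x = b} \<inter> interior K = {}" for u b
  proof -
    define e where "e = (a \<bullet> u - b) / (a \<bullet> u - a \<bullet> w)"
    have "u - e *\<^sub>R (u - w) \<in> interior K"
      using that assms(1,2) by (intro mem_interior_convex_shrink) (auto simp: e_def)
    moreover have "a \<bullet> (u - e *\<^sub>R (u - w)) = b"
      using that(3) by (simp add: inner_diff_right e_def)
    ultimately show False
      using that(4) by auto
  qed
  show "a \<bullet> s < a \<bullet> w"
    using cross[of s' "a \<bullet> s"] assms by (force simp: divide_simps)
  show "a \<bullet> w < a \<bullet> s'"
    using cross[of s "a \<bullet> s'"] assms by (force simp: divide_simps)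
qed

lemma hyperplane_gap:
  fixes K :: "'a::euclidean_space set"
  assumes "convex K" and "cball z r \<subseteq> interior K" and "0 < r" and "a \<noteq> 0"
    and "s \<in> K" "s' \<in> K" and "a \<bullet> s < a \<bullet> s'"
    and disj: "{x. a \<bullet> x = a \<bullet> s} \<inter> interior K = {}" "{x. a \<bullet> x = a \<bullet> s'} \<inter> interior K = {}"
  shows "2 * r * norm a \<le> a \<bullet> s' - a \<bullet> s"
proof -
  \<comment> \<open>\<open>z + v\<close> and \<open>z - v\<close> are the ends of the diameter of
    the ball in direction \<open>a\<close>; both lie strictly between the hyperplanes.\<close>
  define v where "v = (r / norm a) *\<^sub>R a"
  have v: "norm v = r" "a \<bullet> v = r * norm a"
    using assms(3,4) by (simp_all add: v_def power2_eq_square flip: power2_norm_eq_inner)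
  have "z + v \<in> interior K" "z - v \<in> interior K"
    using assms(2) v(1) by (auto simp: subset_iff dist_norm)
  from interior_between_hyperplanes(2)[OF assms(1) this(1) assms(5-)]
    interior_between_hyperplanes(1)[OF assms(1) this(2) assms(5-)]
  show ?thesis
    by (simp add: v inner_add_right inner_diff_right)
qed

lemma setdist_supporting_hyperplanes_ge:
  assumes "convex K" and "cball z r \<subseteq> interior K" and "0 < r"
    and H: "supporting_hyperplane K H" "supporting_hyperplane K H'"
      "parallel_hyperplanes H H'" "H \<noteq> H'"
  shows "2 * r \<le> setdist H H'"
proof -
  obtain a b b' where ab: "a \<noteq> 0" "H = {x. a \<bullet> x = b}" "H' = {x. a \<bullet> x = b'}"
    using H(3) unfolding parallel_hyperplanes_def by blast
  obtain s s' where s: "s \<in> K" "s' \<in> K" "a \<bullet> s = b" "a \<bullet> s' = b'"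
    using H(1,2) ab unfolding supporting_hyperplane_def by blast
  have "b \<noteq> b'"
    using ab H(4) by auto
  \<comment> \<open>Which hyperplane is the higher one along \<open>a\<close> is not known, so both
    orders are covered.\<close>
  then have gap: "2 * r * norm a \<le> \<bar>b' - b\<bar>"
    using hyperplane_gap[OF assms(1-3) ab(1) s(1,2)] hyperplane_gap[OF assms(1-3) ab(1) s(2,1)]
      supporting_hyperplane_disjoint_interior[OF H(1)]
      supporting_hyperplane_disjoint_interior[OF H(2)]
    by (cases "b < b'") (auto simp: ab s)
  show ?thesis
  proof (rule le_setdistI)
    show "H \<noteq> {}" "H' \<noteq> {}"
      using s ab by auto
    fix x y assume "x \<in> H" "y \<in> H'"
    then have "\<bar>b' - b\<bar> = \<bar>a \<bullet> (y - x)\<bar>"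
      by (simp add: ab inner_diff_right)
    also have "\<dots> \<le> norm a * dist x y"
      by (metis Cauchy_Schwarz_ineq2 dist_norm dist_commute)
    finally have "2 * r * norm a \<le> dist x y * norm a"
      using gap by (simp add: mult.commute)
    with ab(1) show "2 * r \<le> dist x y"
      by simp
  qed
qed

text \<open>Positive distances may have infimum 0, so a uniform bound is needed: the diameter of a
  ball inside the body. The set must also be shown nonempty, as \<open>Inf\<close> of the empty set
  carries no information.\<close>

lemma min_width_pos:
  fixes K :: "'a::euclidean_space set"
  assumes "convex_body K"
  shows "0 < min_width K"
proof -
  obtain z where "z \<in> interior K"
    using assms by (auto simp: convex_body_def)
  then obtain r where r: "0 < r" "cball z r \<subseteq> interior K"
    using open_contains_cball open_interior by blast
  obtain a :: 'a where a: "a \<noteq> 0"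
    using nonzero_Basis SOME_Basis by blast
  obtain s t where st: "a \<bullet> t < a \<bullet> s"
    "supporting_hyperplane K {x. a \<bullet> x = a \<bullet> s}" "supporting_hyperplane K {x. a \<bullet> x = a \<bullet> t}"
    using convex_body_opposite_supports[OF assms a] by blast
  moreover have "parallel_hyperplanes {x. a \<bullet> x = a \<bullet> s} {x. a \<bullet> x = a \<bullet> t}"
    unfolding parallel_hyperplanes_def using a by blast
  moreover have "{x. a \<bullet> x = a \<bullet> s} \<noteq> {x. a \<bullet> x = a \<bullet> t}"
    using st(1) by auto
  ultimately have nonempty: "{setdist H H' | H H'. supporting_hyperplane K H \<and>
      supporting_hyperplane K H' \<and> parallel_hyperplanes H H' \<and> H \<noteq> H'} \<noteq> {}"
    by blast
  have "2 * r \<le> min_width K"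
    unfolding min_width_def
    using setdist_supporting_hyperplanes_ge[OF _ r(2,1)] assms
    by (intro cInf_greatest[OF nonempty]) (auto simp: convex_body_def)
  with r(1) show ?thesis
    by simp
qed

lemma family_width_pos:
  assumes "finite \<K>" and "\<K> \<noteq> {}" and "\<And>B. B \<in> \<K> \<Longrightarrow> convex_body B"
  shows "0 < family_width \<K>"
  unfolding family_width_def using assms(1,2) by (subst Min_gr_iff) (auto intro: min_width_pos assms(3))

lemma width_at_least_mono:
  fixes K :: "'a::real_inner set"
  assumes "width_at_least K w" and "w' \<le> w"
  shows "width_at_least K w'"
  unfolding width_at_least_def
proof
  fix a :: 'a
  have "w' * norm a \<le> w * norm a"
    using assms(2) by (intro mult_right_mono) auto
  then show "\<exists>s\<in>K. \<exists>t\<in>K. w' * norm a \<le> a \<bullet> s - a \<bullet> t"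
    using assms(1) unfolding width_at_least_def by (meson order.trans)
qed

section \<open>Norming sets\<close>

text \<open>The sample point near the maximiser may belong to another member of the family, so the
  segment joining them may leave the family; this is why the perturbation bound does not
  require the displaced point to lie in the convex body.\<close>

lemma polyfun_deg_norming_set:
  assumes fin: "finite \<K>" and cb: "\<And>B. B \<in> \<K> \<Longrightarrow> convex_body B"
    and p: "polyfun_deg n p" and "0 < n" and X: "finite X"
    and mesh: "\<And>x. x \<in> \<Union>\<K> \<Longrightarrow> \<exists>y\<in>X. norm (y - x) \<le> family_width \<K> / (8 * (real n)\<^sup>2)"
    and "x \<in> \<Union>\<K>"
  shows "\<bar>p x\<bar> \<le> 2 * Max ((\<lambda>x. \<bar>p x\<bar>) ` X)"
proof -
  have "compact (\<Union>\<K>)"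
    using fin cb by (intro compact_Union) (auto simp: convex_body_def)
  moreover have "continuous_on (\<Union>\<K>) (\<lambda>x. \<bar>p x\<bar>)"
    using polyfun_deg_continuous_on[OF p] by (intro continuous_intros)
  ultimately obtain m where m: "m \<in> \<Union>\<K>" "\<And>y. y \<in> \<Union>\<K> \<Longrightarrow> \<bar>p y\<bar> \<le> \<bar>p m\<bar>"
    using continuous_attains_sup[of "\<Union>\<K>" "\<lambda>x. \<bar>p x\<bar>"] \<open>x \<in> \<Union>\<K>\<close> by blast
  then obtain K where K: "K \<in> \<K>" "m \<in> K"
    by blast
  have "family_width \<K> \<le> min_width K"
    using fin K(1) by (simp add: family_width_def)
  then have width: "width_at_least K (family_width \<K>)"
    using convex_body_width_at_least[OF cb[OF K(1)]] width_at_least_mono by blast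
  have pos: "0 < family_width \<K>"
    using fin cb K(1) by (intro family_width_pos) auto
  have "convex K"
    using cb[OF K(1)] by (simp add: convex_body_def)
  obtain y where y: "y \<in> X" "norm (y - m) \<le> family_width \<K> / (8 * (real n)\<^sup>2)"
    using mesh[OF m(1)] by blast
  \<comment> \<open>The perturbation bound asks for the value M at the maximiser, not just for
    absolute value M; the sign arranges this.\<close>
  define \<sigma> :: real where "\<sigma> = (if p m \<ge> 0 then 1 else -1)"
  have "\<bar>\<sigma> * p z\<bar> \<le> \<bar>p m\<bar>" if "z \<in> K" for z
  proof -
    have "\<bar>p z\<bar> \<le> \<bar>p m\<bar>"
      using m(2)[OF UnionI[OF K(1) that]] .
    then show ?thesis
      by (auto simp: \<sigma>_def)
  qed
  moreover have "\<sigma> * p m = \<bar>p m\<bar>"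
    by (simp add: \<sigma>_def)
  ultimately have "\<bar>\<sigma> * p (m + (y - m)) - \<bar>p m\<bar>\<bar> \<le> \<bar>p m\<bar> / 2"
    using polyfun_deg_perturbation[OF \<open>convex K\<close> width pos K(2) polyfun_deg_cmult[OF p, of \<sigma>] \<open>0 < n\<close> _ _ y(2)]
    by blast
  moreover define t where "t = \<sigma> * p y"
  moreover have "\<bar>t\<bar> = \<bar>p y\<bar>"
    by (simp add: t_def \<sigma>_def)
  ultimately have "\<bar>t - \<bar>p m\<bar>\<bar> \<le> \<bar>p m\<bar> / 2" "\<bar>t\<bar> = \<bar>p y\<bar>"
    by simp_all
  then have "\<bar>p m\<bar> \<le> 2 * \<bar>p y\<bar>"
    by linarith
  moreover have "\<bar>p y\<bar> \<le> Max ((\<lambda>x. \<bar>p x\<bar>) ` X)"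
    using X y(1) by simp
  ultimately show ?thesis
    using m(2)[OF \<open>x \<in> \<Union>\<K>\<close>] by linarith
qed

section \<open>The two polynomial spaces and the mesh constant\<close>

definition total_degree_bound :: "degree_kind \<Rightarrow> nat \<Rightarrow> nat \<Rightarrow> nat" where
  "total_degree_bound D d n = (case D of Total \<Rightarrow> n | Maximum \<Rightarrow> d * n)"

lemma poly_space_polyfun_deg:
  assumes "p \<in> poly_space D n"
  shows "polyfun_deg (total_degree_bound D CARD('d) n) (p :: real^'d \<Rightarrow> real)"
proof -
  have "sum \<alpha> UNIV \<le> total_degree_bound D CARD('d) n"
    if "\<alpha> \<in> exponents D n" for \<alpha> :: "'d \<Rightarrow> nat"
  proof (cases D)
    case Maximum
    then have "\<alpha> r \<le> n" for r
      using that Max_ge[of "range \<alpha>" "\<alpha> r"] by (auto simp del: Max_ge)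
    then have "sum \<alpha> UNIV \<le> CARD('d) * n"
      using sum_bounded_above[of UNIV \<alpha> n] by simp
    with Maximum show ?thesis
      by (simp add: total_degree_bound_def)
  qed (use that in \<open>simp add: total_degree_bound_def\<close>)
  then have "polyfun_deg (total_degree_bound D CARD('d) n)
      (\<lambda>x::real^'d. \<Sum>\<alpha>\<in>exponents D n. coef \<alpha> * (\<Prod>r\<in>UNIV. x $ r ^ \<alpha> r))" for coef
    by (intro polyfun_deg_sum polyfun_deg_cmult polyfun_deg_mono[OF polyfun_deg_monomial]) auto
  with assms show ?thesis
    by (auto simp: poly_space_def)
qed

text \<open>Both kinds reduce to total degree: an exponent with all entries at most n has sum at
  most d n, and since the degree enters squared this yields the d^2 of the maximum degree
  case.\<close>

lemma markov_factor_eq: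
  "markov_factor D (\<K> :: (real^'d) set set) * (real n)\<^sup>2 =
    4 * (real (total_degree_bound D CARD('d) n))\<^sup>2 / family_width \<K>"
  by (cases D) (simp_all add: total_degree_bound_def power_mult_distrib)

text \<open>Finiteness of X turns the infimum into a minimum attained at a sample point. The factor
  sqrt d is the price of passing from \<open>infnorm\<close> to the Euclidean norm.\<close>

lemma mesh_condition_norm:
  fixes X :: "(real^'d) set"
  assumes "mesh_condition \<Omega> X h" and "finite X" and "X \<noteq> {}" and "x \<in> \<Omega>"
  shows "\<exists>y\<in>X. norm (y - x) \<le> sqrt (real CARD('d)) * h"
proof -
  have "(INF y\<in>X. infnorm (y - x)) = Min ((\<lambda>y. infnorm (y - x)) ` X)"
    using assms by (intro cInf_eq_Min) auto
  then have "(INF y\<in>X. infnorm (y - x)) \<in> (\<lambda>y. infnorm (y - x)) ` X"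
    using assms by simp
  then obtain y where y: "y \<in> X" "infnorm (y - x) \<le> h"
    using assms(1,4) unfolding mesh_condition_def by force
  have "norm (y - x) \<le> sqrt (real CARD('d)) * infnorm (y - x)"
    using norm_le_infnorm[of "y - x"] by simp
  also have "\<dots> \<le> sqrt (real CARD('d)) * h"
    using y(2) by (intro mult_left_mono) auto
  finally show ?thesis
    using y(1) by blast
qed

section \<open>Equispaced discretization\<close>

text \<open>A homothety centred at x with ratio e shrinks a ball about an interior point z to a ball
  about a point near x, inside K by convexity. Step and radius are both proportional to e, so
  \<kappa> is independent of \<theta> and x.\<close>

lemma convex_body_inner_ball:
  assumes "convex_body K"
  shows "\<exists>\<kappa>>0. \<forall>\<theta>\<in>{0<..1}. \<forall>x\<in>K. \<exists>x'\<in>K. norm (x' - x) \<le> \<theta> \<and> cball x' (\<kappa> * \<theta>) \<subseteq> K"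
proof -
  obtain z where "z \<in> interior K"
    using assms by (auto simp: convex_body_def)
  then obtain r where r: "0 < r" "cball z r \<subseteq> interior K"
    using open_contains_cball open_interior by blast
  have "convex K" "bounded K"
    using assms by (auto simp: convex_body_def compact_imp_bounded)
  then obtain R where R: "\<And>x. x \<in> K \<Longrightarrow> dist z x \<le> R"
    unfolding bounded_any_center[of K z] by blast
  have "z \<in> K"
    using \<open>z \<in> interior K\<close> interior_subset by blast
  then have "0 \<le> R"
    using R[of z] by simp
  have "\<exists>x'\<in>K. norm (x' - x) \<le> \<theta> \<and> cball x' (r / (R + 1) * \<theta>) \<subseteq> K"
    if \<theta>: "\<theta> \<in> {0<..1}" and x: "x \<in> K" for \<theta> x
  proof -
    \<comment> \<open>Dividing by R + 1 rather than R gives both e R \<le> \<theta> and e \<le>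
      1.\<close>
    define e where "e = \<theta> / (R + 1)"
    have e: "0 < e" "e \<le> 1" "e * R \<le> \<theta>"
      using \<theta> \<open>0 \<le> R\<close> by (auto simp: e_def field_simps mult_left_le)
    define x' where "x' = x + e *\<^sub>R (z - x)"
    have sub: "cball x' (r / (R + 1) * \<theta>) \<subseteq> K"
    proof
      fix y assume "y \<in> cball x' (r / (R + 1) * \<theta>)"
      then have y: "norm (y - x') \<le> r * e"
        by (simp add: dist_norm norm_minus_commute e_def)
      \<comment> \<open>The preimage of y under the homothety; it lies in the ball about z.\<close>
      define u where "u = z + (1 / e) *\<^sub>R (y - x')"
      have "norm ((1 / e) *\<^sub>R (y - x')) \<le> r"
        using y e by (simp add: divide_le_eq)
      then have "u \<in> cball z r"
        by (simp add: u_def dist_norm)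
      then have "u \<in> K"
        using r(2) interior_subset by blast
      moreover have "y = (1 - e) *\<^sub>R x + e *\<^sub>R u"
        using e by (simp add: u_def x'_def algebra_simps)
      ultimately show "y \<in> K"
        using \<open>convex K\<close> x e by (auto intro: convexD)
    qed
    have "norm (x' - x) = e * dist z x"
      using e by (simp add: x'_def dist_norm)
    also have "\<dots> \<le> \<theta>"
      using e R[OF x] mult_left_mono[of "dist z x" R e] by linarith
    finally have "norm (x' - x) \<le> \<theta>" .
    moreover have "x' \<in> cball x' (r / (R + 1) * \<theta>)"
      using \<theta> r(1) \<open>0 \<le> R\<close> by simp
    ultimately show ?thesis
      using sub by blast
  qed
  then show ?thesis
    using r(1) \<open>0 \<le> R\<close> by (intro exI[of _ "r / (R + 1)"]) auto
qed

lemma convex_family_inner_ball: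
  assumes "finite \<K>" and "\<And>B. B \<in> \<K> \<Longrightarrow> convex_body B"
  shows "\<exists>\<kappa>>0. \<forall>\<theta>\<in>{0<..1}. \<forall>x\<in>\<Union>\<K>. \<exists>x'\<in>\<Union>\<K>. norm (x' - x) \<le> \<theta> \<and> cball x' (\<kappa> * \<theta>) \<subseteq> \<Union>\<K>"
proof -
  have "\<forall>K\<in>\<K>. \<exists>\<kappa>>0. \<forall>\<theta>\<in>{0<..1}. \<forall>x\<in>K. \<exists>x'\<in>K. norm (x' - x) \<le> \<theta> \<and> cball x' (\<kappa> * \<theta>) \<subseteq> K"
    using assms(2) convex_body_inner_ball by blast
  then obtain \<kappa> where \<kappa>: "\<And>K. K \<in> \<K> \<Longrightarrow> 0 < \<kappa> K"
    "\<And>K \<theta> x. \<lbrakk>K \<in> \<K>; \<theta> \<in> {0<..1}; x \<in> K\<rbrakk> \<Longrightarrow> \<exists>x'\<in>K. norm (x' - x) \<le> \<theta> \<and> cball x' (\<kappa> K * \<theta>) \<subseteq> K"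
    by (metis (no_types, lifting))
  define k where "k = Min (insert 1 (\<kappa> ` \<K>))"
  have "0 < k"
    using assms(1) \<kappa>(1) by (simp add: k_def)
  moreover have "\<exists>x'\<in>\<Union>\<K>. norm (x' - x) \<le> \<theta> \<and> cball x' (k * \<theta>) \<subseteq> \<Union>\<K>"
    if \<theta>: "\<theta> \<in> {0<..1}" and "x \<in> \<Union>\<K>" for \<theta> x
  proof -
    obtain K where K: "K \<in> \<K>" "x \<in> K"
      using \<open>x \<in> \<Union>\<K>\<close> by blast
    obtain x' where x': "x' \<in> K" "norm (x' - x) \<le> \<theta>" "cball x' (\<kappa> K * \<theta>) \<subseteq> K"
      using \<kappa>(2)[OF K(1) \<theta> K(2)] by blast
    have "k \<le> \<kappa> K"
      using assms(1) K(1) by (simp add: k_def)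
    then have "k * \<theta> \<le> \<kappa> K * \<theta>"
      using \<theta> by (intro mult_right_mono) auto
    then have "cball x' (k * \<theta>) \<subseteq> K"
      using subset_cball[of "k * \<theta>" "\<kappa> K * \<theta>" x'] x'(3) by blast
    with x' K(1) show ?thesis
      by blast
  qed
  ultimately show ?thesis
    by blast
qed

lemma equispaced_grid_dense:
  fixes x :: "real^'d"
  assumes "0 < L" and "0 < m" and "x \<in> hypercube a L"
  shows "\<exists>y\<in>equispaced_grid a L m. norm (y - x) \<le> real CARD('d) * (L / real m)"
proof -
  \<comment> \<open>Rounding down keeps every index at most m, since the quotient is at most m
    inside the cube.\<close>
  define i where "i r = nat \<lfloor>(x $ r - a $ r) / (L / real m)\<rfloor>" for r
  define y where "y = (\<chi> r. a $ r + real (i r) * (L / real m))"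
  have step: "0 < L / real m"
    using assms by simp
  have i: "i r \<le> m" "\<bar>y $ r - x $ r\<bar> \<le> L / real m" for r
  proof -
    have x: "0 \<le> x $ r - a $ r" "x $ r - a $ r \<le> L"
      using assms(3) by (auto simp: hypercube_def algebra_simps)
    define q where "q = (x $ r - a $ r) / (L / real m)"
    have "(x $ r - a $ r) * real m \<le> L * real m"
      using x(2) by (intro mult_right_mono) auto
    then have q: "0 \<le> q" "q \<le> real m" "x $ r = a $ r + q * (L / real m)"
      using x(1) assms(1,2) by (simp_all add: q_def divide_le_eq mult.commute)
    have ir: "real (i r) \<le> q" "q \<le> real (i r) + 1"
      using q(1) unfolding i_def q_def[symmetric] by linarith+
    show "i r \<le> m"
      using ir q(2) by linarith
    have "y $ r - x $ r = (real (i r) - q) * (L / real m)"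
      unfolding q(3) by (simp add: y_def algebra_simps)
    also have "\<bar>\<dots>\<bar> \<le> 1 * (L / real m)"
      unfolding abs_mult using ir step by (intro mult_mono) auto
    finally show "\<bar>y $ r - x $ r\<bar> \<le> L / real m"
      by simp
  qed
  have "y \<in> equispaced_grid a L m"
    using i(1) by (auto simp: equispaced_grid_def y_def)
  moreover have "norm (y - x) \<le> (\<Sum>r\<in>UNIV. \<bar>(y - x) $ r\<bar>)"
    by (rule norm_le_l1_cart)
  moreover have "\<dots> \<le> real CARD('d) * (L / real m)"
    using sum_bounded_above[of UNIV "\<lambda>r. \<bar>(y - x) $ r\<bar>" "L / real m"] i(2) by simp
  ultimately show ?thesis
    by force
qed

section \<open>Counting grid points and basis functions\<close>

lemma card_equispaced_grid_le:
  fixes a :: "real^'d"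
  shows "finite (equispaced_grid a L m)" "card (equispaced_grid a L m) \<le> (m + 1) ^ CARD('d)"
proof -
  define F where "F = (UNIV :: 'd set) \<rightarrow>\<^sub>E {..m}"
  define g where "g i = (\<chi> r. a $ r + real (i r) * (L / real m))" for i :: "'d \<Rightarrow> nat"
  have F: "finite F" "card F = (m + 1) ^ CARD('d)"
    by (auto simp: F_def finite_PiE card_PiE)
  have sub: "equispaced_grid a L m \<subseteq> g ` F"
  proof
    fix x assume "x \<in> equispaced_grid a L m"
    then have "\<forall>r. \<exists>i\<le>m. x $ r = a $ r + real i * (L / real m)"
      by (simp add: equispaced_grid_def)
    then obtain i where "\<And>r. i r \<le> m" "\<And>r. x $ r = a $ r + real (i r) * (L / real m)"
      by metis
    then have "i \<in> F" "x = g i"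
      by (auto simp: F_def g_def vec_eq_iff)
    then show "x \<in> g ` F"
      by blast
  qed
  then show "finite (equispaced_grid a L m)"
    using F(1) finite_surj by blast
  show "card (equispaced_grid a L m) \<le> (m + 1) ^ CARD('d)"
    using surj_card_le[OF F(1) sub] F(2) by simp
qed

text \<open>Either exponent set lies between the cubes of side n div d and n, which gives the order
  n^d for both kinds without evaluating a binomial coefficient.\<close>

lemma card_exponents_bounds:
  fixes D n
  defines "N \<equiv> card (exponents D n :: ('d::finite \<Rightarrow> nat) set)"
  shows "N \<le> (n + 1) ^ CARD('d)" and "(n div CARD('d) + 1) ^ CARD('d) \<le> N"
proof -
  have card: "card ((UNIV :: 'd set) \<rightarrow>\<^sub>E {..k}) = (k + 1) ^ CARD('d)" for k :: nat
    by (simp add: card_PiE)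
  have "\<alpha> r \<le> n" if "\<alpha> \<in> exponents D n" for \<alpha> :: "'d \<Rightarrow> nat" and r
    using that member_le_sum[of r UNIV \<alpha>] Max_ge[of "range \<alpha>" "\<alpha> r"]
    by (cases D) (auto simp del: Max_ge)
  then have "exponents D n \<subseteq> (UNIV :: 'd set) \<rightarrow>\<^sub>E {..n}"
    by auto
  from card_mono[OF _ this] show "N \<le> (n + 1) ^ CARD('d)"
    by (simp add: card N_def finite_PiE)
  have "\<alpha> \<in> exponents D n" if "\<And>r. \<alpha> r \<le> n div CARD('d)" for \<alpha> :: "'d \<Rightarrow> nat"
  proof (cases D)
    case Total
    have "sum \<alpha> UNIV \<le> CARD('d) * (n div CARD('d))"
      using sum_bounded_above[of UNIV \<alpha> "n div CARD('d)"] that by simp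
    also have "\<dots> \<le> n"
      by simp
    finally show ?thesis
      using Total by simp
  next
    case Maximum
    have "\<alpha> r \<le> n" for r
      using that[of r] div_le_dividend order.trans by blast
    with Maximum show ?thesis
      by simp
  qed
  then have "(UNIV :: 'd set) \<rightarrow>\<^sub>E {..n div CARD('d)} \<subseteq> exponents D n"
    by auto
  from card_mono[OF finite_exponents this] show "(n div CARD('d) + 1) ^ CARD('d) \<le> N"
    by (simp only: card N_def)
qed

text \<open>The inequalities n \<le> d (n div d + 1) and, for n \<ge> 1, n + 1 \<le> 2 n turn the
  cube bounds into the factors d^d and 2^d, which are then squared.\<close>

lemma card_exponents_bigtheta:
  "(\<lambda>n. real n ^ (2 * CARD('d))) \<in> \<Theta>(\<lambda>n. real (card (exponents D n :: ('d::finite \<Rightarrow> nat) set)) ^ 2)"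
proof (rule bigthetaI)
  let ?N = "\<lambda>n. card (exponents D n :: ('d \<Rightarrow> nat) set)"
  let ?d = "CARD('d)"
  have "real n ^ ?d \<le> real ?d ^ ?d * real (?N n)" for n
  proof -
    have "n \<le> ?d * (n div ?d + 1)"
      using dividend_less_times_div[of ?d n] by simp
    then have "n ^ ?d \<le> (?d * (n div ?d + 1)) ^ ?d"
      by (rule power_mono) simp
    also have "\<dots> \<le> ?d ^ ?d * ?N n"
      unfolding power_mult_distrib by (intro mult_left_mono card_exponents_bounds(2)) simp
    finally show ?thesis
      by (metis of_nat_le_iff of_nat_mult of_nat_power)
  qed
  then have "real n ^ (2 * ?d) \<le> (real ?d ^ ?d)\<^sup>2 * (real (?N n))\<^sup>2" for n
    using power_mono[of "real n ^ ?d" "real ?d ^ ?d * real (?N n)" 2]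
    by (simp add: power_mult_distrib mult.commute flip: power_mult)
  then show "(\<lambda>n. real n ^ (2 * ?d)) \<in> O(\<lambda>n. (real (?N n))\<^sup>2)"
    by (intro bigoI[where c = "(real ?d ^ ?d)\<^sup>2"] always_eventually) simp
  have "real (?N n) \<le> 2 ^ ?d * real n ^ ?d" if "n \<ge> 1" for n
  proof -
    have "?N n \<le> (n + 1) ^ ?d"
      by (rule card_exponents_bounds)
    also have "\<dots> \<le> (2 * n) ^ ?d"
      using that by (intro power_mono) auto
    finally have "real (?N n) \<le> real ((2 * n) ^ ?d)"
      by (simp only: of_nat_le_iff)
    then show ?thesis
      by (simp add: power_mult_distrib)
  qed
  then have "(real (?N n))\<^sup>2 \<le> (2 ^ ?d)\<^sup>2 * real n ^ (2 * ?d)" if "n \<ge> 1" for n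
    using power_mono[of "real (?N n)" "2 ^ ?d * real n ^ ?d" 2] that
    by (simp add: power_mult_distrib mult.commute flip: power_mult)
  then show "(\<lambda>n. real n ^ (2 * ?d)) \<in> \<Omega>(\<lambda>n. (real (?N n))\<^sup>2)"
    unfolding bigomega_iff_bigo
    by (intro bigoI[where c = "(2 ^ ?d)\<^sup>2"] eventually_mono[OF eventually_ge_at_top[of 1]]) simp
qed

lemma equispaced_discretization:
  fixes \<Omega> :: "(real^'d) set"
  assumes "finite \<K>" and "\<K> \<noteq> {}" and cb: "\<And>B. B \<in> \<K> \<Longrightarrow> convex_body B" and "\<Omega> = \<Union>\<K>"
    and "0 < L" and box: "\<Omega> \<subseteq> hypercube a L" and "0 < h"
  shows "\<exists>m. (\<forall>n\<ge>1. 0 < m n \<and> equispaced_grid a L (m n) \<inter> \<Omega> \<noteq> {} \<and>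
                mesh_condition \<Omega> (equispaced_grid a L (m n) \<inter> \<Omega>) (h / real n ^ 2)) \<and>
             (\<lambda>n. real (card (equispaced_grid a L (m n) \<inter> \<Omega>))) \<in> O(\<lambda>n. real n ^ (2 * CARD('d)))"
proof -
  obtain \<kappa>' where "0 < \<kappa>'" "\<forall>\<theta>\<in>{0<..1}. \<forall>x\<in>\<Omega>. \<exists>x'\<in>\<Omega>. norm (x' - x) \<le> \<theta> \<and> cball x' (\<kappa>' * \<theta>) \<subseteq> \<Omega>"
    using convex_family_inner_ball[OF assms(1) cb] unfolding assms(4) by blast
  then have \<kappa>': "0 < \<kappa>'" "\<And>\<theta> x. \<lbrakk>0 < \<theta>; \<theta> \<le> 1; x \<in> \<Omega>\<rbrakk> \<Longrightarrow>
      \<exists>x'\<in>\<Omega>. norm (x' - x) \<le> \<theta> \<and> cball x' (\<kappa>' * \<theta>) \<subseteq> \<Omega>"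
    by auto
  \<comment> \<open>The mesh width is split in two: one half for the inward move, one for the
    rounding. Capping b at 1 keeps \<theta> in the range of the inner ball property; capping
    \<kappa> at 1 keeps the rounding error below \<theta>.\<close>
  define \<kappa> where "\<kappa> = min 1 \<kappa>'"
  define b where "b = min 1 (h / 2)"
  have b: "0 < b" "b \<le> 1" "2 * b \<le> h" and \<kappa>: "0 < \<kappa>" "\<kappa> \<le> 1" "\<kappa> \<le> \<kappa>'"
    using \<open>0 < h\<close> \<kappa>'(1) by (auto simp: b_def \<kappa>_def)
  \<comment> \<open>C is chosen so that with C n^2 intervals the rounding error is at most \<kappa>
    \<theta>; it does not depend on n.\<close>
  obtain C :: nat where C: "real CARD('d) * L / (\<kappa> * b) \<le> real C"
    using real_arch_simple by blast
  have "0 < C"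
  proof -
    have "0 < real CARD('d) * L / (\<kappa> * b)"
      using b \<kappa> \<open>0 < L\<close> by simp
    with C show ?thesis
      by simp
  qed
  define m where "m n = C * n\<^sup>2" for n
  have near: "\<exists>y\<in>equispaced_grid a L (m n) \<inter> \<Omega>. norm (y - x) \<le> h / (real n)\<^sup>2"
    if "n \<ge> 1" "x \<in> \<Omega>" for n x
  proof -
    define \<theta> where "\<theta> = b / (real n)\<^sup>2"
    have n2: "(1::real) \<le> (real n)\<^sup>2"
      using that(1) by simp
    have "b \<le> (real n)\<^sup>2"
      using b(2) n2 by linarith
    then have \<theta>: "0 < \<theta>" "\<theta> \<le> 1"
      using b(1) that(1) by (simp_all add: \<theta>_def divide_le_eq)
    obtain x' where x': "x' \<in> \<Omega>" "norm (x' - x) \<le> \<theta>" "cball x' (\<kappa>' * \<theta>) \<subseteq> \<Omega>"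
      using \<kappa>'(2)[OF \<theta> \<open>x \<in> \<Omega>\<close>] by blast
    obtain y where y: "y \<in> equispaced_grid a L (m n)" "norm (y - x') \<le> real CARD('d) * (L / real (m n))"
      using equispaced_grid_dense[of L "m n" x' a] x'(1) box \<open>0 < L\<close> \<open>0 < C\<close> \<open>n \<ge> 1\<close>
      by (auto simp: m_def)
    have "real CARD('d) * L \<le> real C * (\<kappa> * b)"
      using C b \<kappa> by (simp add: divide_le_eq)
    then have "real CARD('d) * (L / real (m n)) \<le> \<kappa> * \<theta>"
      using \<open>0 < C\<close> that(1) by (simp add: m_def \<theta>_def field_simps)
    with y(2) have yx': "norm (y - x') \<le> \<kappa> * \<theta>"
      by linarith
    also have "\<dots> \<le> \<kappa>' * \<theta>"
      using \<kappa> \<theta> by simp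
    finally have "y \<in> \<Omega>"
      using x'(3) by (auto simp: dist_norm norm_minus_commute)
    have "norm (y - x) \<le> norm (y - x') + norm (x' - x)"
      using norm_triangle_ineq[of "y - x'" "x' - x"] by simp
    also have "\<dots> \<le> \<theta> + \<theta>"
      using yx' x'(2) \<kappa> \<theta> mult_right_mono[of \<kappa> 1 \<theta>] by linarith
    also have "\<dots> \<le> h / (real n)\<^sup>2"
      using b n2 by (simp add: \<theta>_def divide_right_mono flip: add_divide_distrib)
    finally show ?thesis
      using y(1) \<open>y \<in> \<Omega>\<close> by blast
  qed
  have "\<Omega> \<noteq> {}"
    using assms(2,4) cb interior_empty by (fastforce simp: convex_body_def)
  have "mesh_condition \<Omega> (equispaced_grid a L (m n) \<inter> \<Omega>) (h / real n ^ 2)" if "n \<ge> 1" for n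
    unfolding mesh_condition_def
  proof
    fix x assume "x \<in> \<Omega>"
    then obtain y where y: "y \<in> equispaced_grid a L (m n) \<inter> \<Omega>" "norm (y - x) \<le> h / (real n)\<^sup>2"
      using near \<open>n \<ge> 1\<close> by blast
    have "(INF y\<in>equispaced_grid a L (m n) \<inter> \<Omega>. infnorm (y - x)) \<le> infnorm (y - x)"
      by (intro cINF_lower[OF _ y(1)] bdd_belowI2[of _ 0]) (simp add: infnorm_pos_le)
    also have "\<dots> \<le> h / (real n)\<^sup>2"
      using y(2) infnorm_le_norm order.trans by blast
    finally show "(INF y\<in>equispaced_grid a L (m n) \<inter> \<Omega>. infnorm (y - x)) \<le> h / (real n)\<^sup>2" .
  qed
  moreover have "equispaced_grid a L (m n) \<inter> \<Omega> \<noteq> {}" if "n \<ge> 1" for n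
    using near[OF that] \<open>\<Omega> \<noteq> {}\<close> by blast
  moreover have "0 < m n" if "n \<ge> 1" for n
    using that \<open>0 < C\<close> by (simp add: m_def)
  moreover have "(\<lambda>n. real (card (equispaced_grid a L (m n) \<inter> \<Omega>))) \<in> O(\<lambda>n. real n ^ (2 * CARD('d)))"
  proof (intro bigoI[where c = "real (C + 1) ^ CARD('d)"] eventually_mono[OF eventually_ge_at_top[of 1]])
    fix n :: nat assume "1 \<le> n"
    have "card (equispaced_grid a L (m n) \<inter> \<Omega>) \<le> card (equispaced_grid a L (m n))"
      by (intro card_mono card_equispaced_grid_le) auto
    also have "\<dots> \<le> (m n + 1) ^ CARD('d)"
      by (rule card_equispaced_grid_le)
    \<comment> \<open>The extra point per side is absorbed because n^2 \<ge> 1.\<close>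
    also have "\<dots> \<le> ((C + 1) * n\<^sup>2) ^ CARD('d)"
      using \<open>1 \<le> n\<close> by (intro power_mono) (auto simp: m_def)
    also have "\<dots> = (C + 1) ^ CARD('d) * n ^ (2 * CARD('d))"
      by (simp only: power_mult_distrib power_mult)
    finally have "real (card (equispaced_grid a L (m n) \<inter> \<Omega>)) \<le> real ((C + 1) ^ CARD('d) * n ^ (2 * CARD('d)))"
      by (simp only: of_nat_le_iff)
    then show "norm (real (card (equispaced_grid a L (m n) \<inter> \<Omega>)))
        \<le> real (C + 1) ^ CARD('d) * norm (real n ^ (2 * CARD('d)))"
      by simp
  qed
  ultimately show ?thesis
    by blast
qed

theorem theorem4p2:
  fixes \<K> :: "(real ^ 'd) set set" and \<Omega> :: "(real ^ 'd) set"
    and c :: real and D :: degree_kind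
  assumes "CARD('d) > 1"
    and "finite \<K>" and "\<K> \<noteq> {}" and "\<And>B. B \<in> \<K> \<Longrightarrow> convex_body B"
    and "\<Omega> = \<Union>\<K>"
    and "0 < c" and "c \<le> 1 / (2 * sqrt (real CARD('d)))"
  shows
    "(\<forall>n\<ge>1. \<forall>X. finite X \<and> X \<noteq> {} \<and> X \<subseteq> \<Omega> \<and>
        mesh_condition \<Omega> X (c / (markov_factor D \<K> * real n ^ 2)) \<longrightarrow>
        (\<forall>p \<in> poly_space D n. (SUP x\<in>\<Omega>. \<bar>p x\<bar>) \<le> 2 * Max ((\<lambda>x. \<bar>p x\<bar>) ` X)))
     \<and>
     (\<forall>a L. 0 < L \<and> \<Omega> \<subseteq> hypercube a L \<longrightarrow>
        (\<exists>m. (\<forall>n\<ge>1. 0 < m n \<and> equispaced_grid a L (m n) \<inter> \<Omega> \<noteq> {} \<and>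
                mesh_condition \<Omega> (equispaced_grid a L (m n) \<inter> \<Omega>)
                  (c / (markov_factor D \<K> * real n ^ 2))) \<and>
             (\<lambda>n. real (card (equispaced_grid a L (m n) \<inter> \<Omega>)))
               \<in> O(\<lambda>n. real n ^ (2 * CARD('d)))))
     \<and>
     O(\<lambda>n. real n ^ (2 * CARD('d))) =
       O(\<lambda>n. real (card (exponents D n :: ('d \<Rightarrow> nat) set)) ^ 2)"
proof (intro conjI allI impI ballI)
  have pos: "0 < family_width \<K>"
    using assms by (intro family_width_pos) auto
  fix n and X :: "(real ^ 'd) set" and p :: "real ^ 'd \<Rightarrow> real"
  assume n: "1 \<le> n" and p: "p \<in> poly_space D n"
    and X: "finite X \<and> X \<noteq> {} \<and> X \<subseteq> \<Omega> \<and> mesh_condition \<Omega> X (c / (markov_factor D \<K> * real n ^ 2))"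
  \<comment> \<open>Here \<open>N\<close> is the total degree bound, not the number of basis
    functions.\<close>
  define N where "N = total_degree_bound D CARD('d) n"
  have N: "0 < N"
    using n by (cases D) (auto simp: N_def total_degree_bound_def)
  \<comment> \<open>The bound on \<open>c\<close> makes sqrt d times c at most 1/2, and halving w /
    (4 N^2) gives exactly the radius of the perturbation bound.\<close>
  have "sqrt (real CARD('d)) * (c / (markov_factor D \<K> * real n ^ 2))
      = (sqrt (real CARD('d)) * c) * (family_width \<K> / (4 * (real N)\<^sup>2))"
    by (simp add: markov_factor_eq N_def)
  also have "\<dots> \<le> 1 / 2 * (family_width \<K> / (4 * (real N)\<^sup>2))"
    using assms(7) pos by (intro mult_right_mono) (auto simp: field_simps)
  finally have radius: "sqrt (real CARD('d)) * (c / (markov_factor D \<K> * real n ^ 2))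
      \<le> family_width \<K> / (8 * (real N)\<^sup>2)"
    by simp
  have mesh: "\<exists>y\<in>X. norm (y - x) \<le> family_width \<K> / (8 * (real N)\<^sup>2)" if "x \<in> \<Union>\<K>" for x
    using mesh_condition_norm[of \<Omega> X _ x] X that radius assms(5) by (meson order.trans)
  have "\<bar>p x\<bar> \<le> 2 * Max ((\<lambda>x. \<bar>p x\<bar>) ` X)" if "x \<in> \<Omega>" for x
    using polyfun_deg_norming_set[OF assms(2,4) poly_space_polyfun_deg[OF p, folded N_def] N _ mesh]
      X that assms(5) by blast
  moreover have "\<Omega> \<noteq> {}"
    using X by blast
  ultimately show "(SUP x\<in>\<Omega>. \<bar>p x\<bar>) \<le> 2 * Max ((\<lambda>x. \<bar>p x\<bar>) ` X)"
    by (intro cSUP_least)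
next
  fix a L assume box: "0 < L \<and> \<Omega> \<subseteq> hypercube a L"
  have "0 < family_width \<K>"
    using assms by (intro family_width_pos) auto
  then have "0 < c / markov_factor D \<K>"
    using assms(6) by (cases D) auto
  from equispaced_discretization[OF assms(2-5) _ _ this, of L a] box
  show "\<exists>m. (\<forall>n\<ge>1. 0 < m n \<and> equispaced_grid a L (m n) \<inter> \<Omega> \<noteq> {} \<and>
                mesh_condition \<Omega> (equispaced_grid a L (m n) \<inter> \<Omega>)
                  (c / (markov_factor D \<K> * real n ^ 2))) \<and>
             (\<lambda>n. real (card (equispaced_grid a L (m n) \<inter> \<Omega>)))
               \<in> O(\<lambda>n. real n ^ (2 * CARD('d)))"
    by simp
next
  show "O(\<lambda>n. real n ^ (2 * CARD('d))) =
       O(\<lambda>n. real (card (exponents D n :: ('d \<Rightarrow> nat) set)) ^ 2)"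
    by (rule landau_o.big.cong_bigtheta[OF card_exponents_bigtheta])
qed

end
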